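(* Let $X$ be a set with at least two elements, let $\theta$ be a permutation of $X$, and let $(\Pi(X),\mathscr P(X);\Gamma_\theta)$ be the cross-connection given by $\Gamma_\theta(\bar\pi)=\overline{\theta^{-1}(\pi)}$ and $\Gamma_\theta(\eta^\ast)=(\theta\eta\theta^{-1})^\ast$. Then the cross-connection semigroup $\tilde S\Gamma_\theta$ is isomorphic to $Sing(X)$.
   Context: All maps and morphisms are composed from left to right. $Sing(X)$ is the set of all non-invertible transformations of $X$, taken to be a (regular) subsemigroup, under composition, of the full transformation semigroup $\mathscr T_X$. $\pi_a$ is the kernel partition (non-empty fibres) of a transformation $a$. Powerset category $\mathscr P(X)$: objects are the non-empty proper subsets of $X$; morphisms $A\to B$ are all functions; inclusions are set inclusions. Category of partitions $\Pi(X)$: a partition is non-identity if at least one block has more than one element. For such $\pi$, $\bar\pi$ is the set of all functions from (the set of blocks) $\pi$ to $X$. Objects are the $\bar\pi$; morphisms $\bar\pi_1\to\bar\pi_2$ are the maps $\eta^\ast:\alpha\mapsto\eta\alpha$ for functions $\eta:\pi_2\to\pi_1$. Write $\bar\pi_1\subseteq\bar\pi_2$ if every block of $\pi_2$ lies in a block of $\pi_1$. For a partition $\pi$, $\theta^{-1}(\pi)=\{\theta^{-1}(A):A\in\pi\}$; for $\eta:\pi_2\to\pi_1$, $\theta\eta\theta^{-1}:\theta^{-1}(\pi_2)\to\theta^{-1}(\pi_1)$ is $B\mapsto\theta^{-1}((\theta(B))\eta)$. Identify $N^\ast\mathscr P(X)$ with $\Pi(X)$ and $N^\ast\Pi(X)$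 with $\mathscr P(X)$. The dual cross-connection of $\Gamma_\theta$ is $\Delta_\theta:\mathscr P(X)\to\mathscr P(X)$, $\Delta_\theta(A)=\theta(A)$, $\Delta_\theta(f)=\theta^{-1}f\theta$. For objects $A$ of $\mathscr P(X)$ and $\bar\pi$ of $\Pi(X)$ put $\Gamma_\theta(A,\bar\pi)=\{a\in Sing(X):\mathrm{Im}\,a\subseteq A,\ \bar\pi_a\subseteq\Gamma_\theta(\bar\pi)\}$ and $\Delta_\theta(A,\bar\pi)=\{b\in Sing(X):\mathrm{Im}\,b\subseteq\theta(A),\ \bar\pi_b\subseteq\bar\pi\}$. The duality associated with $\Gamma_\theta$ is the natural isomorphism $\chi_{\Gamma_\theta}(A,\bar\pi):\Gamma_\theta(A,\bar\pi)\to\Delta_\theta(A,\bar\pi)$, $a\mapsto\theta^{-1}a\theta$. Let $U\Gamma_\theta=\bigcup_{A,\bar\pi}\Gamma_\theta(A,\bar\pi)$ (with composition of transformations) and $U\Delta_\theta=\bigcup_{A,\bar\pi}\Delta_\theta(A,\bar\pi)$ (with the opposite multiplication $b'\ast b=bb'$). An element $a\in U\Gamma_\theta$ is linked to $b\in U\Delta_\theta$ if there is a pair $(A,\bar\pi)$ with $a\in\Gamma_\theta(A,\bar\pi)$ and $b=\chi_{\Gamma_\theta}(A,\bar\pi)(a)$. The cross-connection semigroup is $\tilde S\Gamma_\theta=\{(a,b)\in U\Gamma_\theta\times U\Delta_\theta: a\text{ is linked to }b\}$ with $(a,b)\circ(a',b')=(aa',\,b'\ast b)$.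
   Formalization: The formal theorem assumes that Sing(X) is closed under composition, which holds exactly when X is finite; for infinite X the non-invertible transformations do not form a semigroup and the claim fails. *)

theory Defs
  imports "HOL-Algebra.Group" "HOL-Library.Disjoint_Sets"
begin

section \<open>Transformations\<close>

text \<open>Maps are composed from left to right, and transformations of a set \<open>X\<close> are the
  extensional functions on \<open>X\<close>.\<close>

definition full_transf :: "'a set \<Rightarrow> ('a \<Rightarrow> 'a) monoid" where
  "full_transf X = \<lparr>carrier = X \<rightarrow>\<^sub>E X, mult = (\<lambda>a b. compose X b a), one = (\<lambda>x\<in>X. x)\<rparr>"

definition Sing_set :: "'a set \<Rightarrow> ('a \<Rightarrow> 'a) set" where
  "Sing_set X = carrier (full_transf X) - Units (full_transf X)"

text \<open>HOL-Algebra has no record type for semigroups. The semigroups below are \<open>monoid\<close> records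
  whose field \<open>one\<close> need not lie in the carrier and has no meaning; \<open>hom\<close>, \<open>iso\<close> and \<open>\<cong>\<close>
  do not refer to that field.\<close>

definition Sing :: "'a set \<Rightarrow> ('a \<Rightarrow> 'a) monoid" where
  "Sing X = (full_transf X)\<lparr>carrier := Sing_set X\<rparr>"

definition subsemigroup :: "'b set \<Rightarrow> ('b, 'c) monoid_scheme \<Rightarrow> bool" where
  "subsemigroup H G \<longleftrightarrow> H \<subseteq> carrier G \<and> (\<forall>a\<in>H. \<forall>b\<in>H. a \<otimes>\<^bsub>G\<^esub> b \<in> H)"

definition kernel_partition :: "'a set \<Rightarrow> ('a \<Rightarrow> 'a) \<Rightarrow> 'a set set" where
  "kernel_partition X a = (\<lambda>y. {x\<in>X. a x = y}) ` (a ` X)"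


section \<open>The powerset category and the category of partitions\<close>

definition powerset_objects :: "'a set \<Rightarrow> 'a set set" where
  "powerset_objects X = {A. A \<noteq> {} \<and> A \<subset> X}"

definition powerset_hom :: "'a set \<Rightarrow> 'a set \<Rightarrow> ('a \<Rightarrow> 'a) set" where
  "powerset_hom A B = A \<rightarrow>\<^sub>E B"

definition nonidentity :: "'a set set \<Rightarrow> bool" where
  "nonidentity \<pi> \<longleftrightarrow> (\<exists>B\<in>\<pi>. \<exists>x\<in>B. \<exists>y\<in>B. x \<noteq> y)"

type_synonym 'a pobj = "('a set \<Rightarrow> 'a) set"
type_synonym 'a pmor = "('a set \<Rightarrow> 'a) \<Rightarrow> ('a set \<Rightarrow> 'a)"

definition bar :: "'a set \<Rightarrow> 'a set set \<Rightarrow> 'a pobj" where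
  "bar X \<pi> = \<pi> \<rightarrow>\<^sub>E X"

definition partition_objects :: "'a set \<Rightarrow> 'a pobj set" where
  "partition_objects X = {bar X \<pi> | \<pi>. partition_on X \<pi> \<and> nonidentity \<pi>}"

text \<open>The partition \<open>\<pi>\<close> with \<open>P = bar X \<pi>\<close>. It is unique if \<open>X\<close> has at least two elements; see
  \<open>blocks_bar\<close> below.\<close>

definition blocks :: "'a set \<Rightarrow> 'a pobj \<Rightarrow> 'a set set" where
  "blocks X P = (THE \<pi>. partition_on X \<pi> \<and> P = bar X \<pi>)"

definition partition_incl :: "'a set \<Rightarrow> 'a pobj \<Rightarrow> 'a pobj \<Rightarrow> bool" where
  "partition_incl X P Q \<longleftrightarrow> (\<forall>B\<in>blocks X Q. \<exists>C\<in>blocks X P. B \<subseteq> C)"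

text \<open>For \<open>\<eta> : \<pi>\<^sub>2 \<rightarrow> \<pi>\<^sub>1\<close>, the morphism \<open>\<eta>\<^sup>*\<close> from \<open>bar X \<pi>\<^sub>1\<close> to \<open>bar X \<pi>\<^sub>2\<close>.\<close>

definition star :: "'a set \<Rightarrow> 'a set set \<Rightarrow> 'a set set \<Rightarrow> ('a set \<Rightarrow> 'a set) \<Rightarrow> 'a pmor" where
  "star X \<pi>\<^sub>1 \<pi>\<^sub>2 \<eta> = (\<lambda>\<alpha>\<in>bar X \<pi>\<^sub>1. compose \<pi>\<^sub>2 \<alpha> \<eta>)"

definition partition_hom :: "'a set \<Rightarrow> 'a pobj \<Rightarrow> 'a pobj \<Rightarrow> 'a pmor set" where
  "partition_hom X P Q = star X (blocks X P) (blocks X Q) ` (blocks X Q \<rightarrow>\<^sub>E blocks X P)"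


section \<open>The cross-connection and its dual\<close>

text \<open>A morphism is given together with its domain and codomain, so a functor acts on
  morphisms by a family of maps indexed by pairs of objects.\<close>

record ('o, 'm, 'p, 'n) functor_maps =
  on_obj :: "'o \<Rightarrow> 'p"
  on_mor :: "'o \<Rightarrow> 'o \<Rightarrow> 'm \<Rightarrow> 'n"

definition preimages :: "'a set \<Rightarrow> ('a \<Rightarrow> 'a) \<Rightarrow> 'a set set \<Rightarrow> 'a set set" where
  "preimages X \<theta> \<pi> = (\<lambda>A. \<theta> -` A \<inter> X) ` \<pi>"

definition conj_blocks ::
  "'a set \<Rightarrow> ('a \<Rightarrow> 'a) \<Rightarrow> 'a set set \<Rightarrow> ('a set \<Rightarrow> 'a set) \<Rightarrow> ('a set \<Rightarrow> 'a set)" where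
  "conj_blocks X \<theta> \<pi>\<^sub>2 \<eta> = (\<lambda>B\<in>preimages X \<theta> \<pi>\<^sub>2. \<theta> -` (\<eta> (\<theta> ` B)) \<inter> X)"

definition cc_Gamma ::
  "'a set \<Rightarrow> ('a \<Rightarrow> 'a) \<Rightarrow> ('a pobj, 'a pmor, 'a pobj, 'a pmor) functor_maps" where
  "cc_Gamma X \<theta> = \<lparr>
     on_obj = (\<lambda>P. bar X (preimages X \<theta> (blocks X P))),
     on_mor = (\<lambda>P Q f.
       let \<pi>\<^sub>1 = blocks X P; \<pi>\<^sub>2 = blocks X Q;
           \<eta> = (THE \<eta>. \<eta> \<in> \<pi>\<^sub>2 \<rightarrow>\<^sub>E \<pi>\<^sub>1 \<and> f = star X \<pi>\<^sub>1 \<pi>\<^sub>2 \<eta>)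
       in star X (preimages X \<theta> \<pi>\<^sub>1) (preimages X \<theta> \<pi>\<^sub>2) (conj_blocks X \<theta> \<pi>\<^sub>2 \<eta>))\<rparr>"

definition cc_Delta ::
  "'a set \<Rightarrow> ('a \<Rightarrow> 'a) \<Rightarrow> ('a set, 'a \<Rightarrow> 'a, 'a set, 'a \<Rightarrow> 'a) functor_maps" where
  "cc_Delta X \<theta> = \<lparr>
     on_obj = (\<lambda>A. \<theta> ` A),
     on_mor = (\<lambda>A B f. \<lambda>y\<in>\<theta> ` A. \<theta> (f (inv_into X \<theta> y)))\<rparr>"

definition Gamma_bi :: "'a set \<Rightarrow> ('a \<Rightarrow> 'a) \<Rightarrow> 'a set \<Rightarrow> 'a pobj \<Rightarrow> ('a \<Rightarrow> 'a) set" where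
  "Gamma_bi X \<theta> A P = {a \<in> Sing_set X. a ` X \<subseteq> A \<and>
     partition_incl X (bar X (kernel_partition X a)) (on_obj (cc_Gamma X \<theta>) P)}"

definition Delta_bi :: "'a set \<Rightarrow> ('a \<Rightarrow> 'a) \<Rightarrow> 'a set \<Rightarrow> 'a pobj \<Rightarrow> ('a \<Rightarrow> 'a) set" where
  "Delta_bi X \<theta> A P = {b \<in> Sing_set X. b ` X \<subseteq> on_obj (cc_Delta X \<theta>) A \<and>
     partition_incl X (bar X (kernel_partition X b)) P}"

definition duality ::
  "'a set \<Rightarrow> ('a \<Rightarrow> 'a) \<Rightarrow> 'a set \<Rightarrow> 'a pobj \<Rightarrow> ('a \<Rightarrow> 'a) \<Rightarrow> ('a \<Rightarrow> 'a)" where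
  "duality X \<theta> A P = (\<lambda>a\<in>Gamma_bi X \<theta> A P. compose X \<theta> (compose X a (inv_into X \<theta>)))"

definition U_Gamma :: "'a set \<Rightarrow> ('a \<Rightarrow> 'a) \<Rightarrow> ('a \<Rightarrow> 'a) monoid" where
  "U_Gamma X \<theta> = (full_transf X)
     \<lparr>carrier := (\<Union>A\<in>powerset_objects X. \<Union>P\<in>partition_objects X. Gamma_bi X \<theta> A P)\<rparr>"

definition U_Delta :: "'a set \<Rightarrow> ('a \<Rightarrow> 'a) \<Rightarrow> ('a \<Rightarrow> 'a) monoid" where
  "U_Delta X \<theta> = (full_transf X)
     \<lparr>carrier := (\<Union>A\<in>powerset_objects X. \<Union>P\<in>partition_objects X. Delta_bi X \<theta> A P),
      mult := (\<lambda>b' b. b \<otimes>\<^bsub>full_transf X\<^esub> b')\<rparr>"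

definition linked :: "'a set \<Rightarrow> ('a \<Rightarrow> 'a) \<Rightarrow> ('a \<Rightarrow> 'a) \<Rightarrow> ('a \<Rightarrow> 'a) \<Rightarrow> bool" where
  "linked X \<theta> a b \<longleftrightarrow> (\<exists>A\<in>powerset_objects X. \<exists>P\<in>partition_objects X.
     a \<in> Gamma_bi X \<theta> A P \<and> b = duality X \<theta> A P a)"

definition cc_semigroup :: "'a set \<Rightarrow> ('a \<Rightarrow> 'a) \<Rightarrow> (('a \<Rightarrow> 'a) \<times> ('a \<Rightarrow> 'a)) monoid" where
  "cc_semigroup X \<theta> = \<lparr>
     carrier = {(a, b). a \<in> carrier (U_Gamma X \<theta>) \<and> b \<in> carrier (U_Delta X \<theta>) \<and> linked X \<theta> a b},
     mult = (\<lambda>(a, b) (a', b'). (a \<otimes>\<^bsub>U_Gamma X \<theta>\<^esub> a', b' \<otimes>\<^bsub>U_Delta X \<theta>\<^esub> b)),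
     one = (\<one>\<^bsub>U_Gamma X \<theta>\<^esub>, \<one>\<^bsub>U_Delta X \<theta>\<^esub>)\<rparr>"


section \<open>Sanity checks\<close>

lemma bar_inj:
  assumes X: "x \<in> X" "y \<in> X" "x \<noteq> y" and eq: "bar X \<pi> = bar X \<rho>"
  shows "\<pi> = \<rho>"
proof -
  have *: "\<sigma> \<subseteq> \<tau>" if "bar X \<sigma> = bar X \<tau>" for \<sigma> \<tau>
  proof (rule ccontr)
    assume "\<not> \<sigma> \<subseteq> \<tau>"
    then obtain B where B: "B \<in> \<sigma>" "B \<notin> \<tau>" by blast
    have "(\<lambda>C\<in>\<sigma>. x) \<in> bar X \<tau>" "(\<lambda>C\<in>\<sigma>. y) \<in> bar X \<tau>"
      unfolding that[symmetric] using X by (auto simp: bar_def)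
    then have "(\<lambda>C\<in>\<sigma>. x) B = undefined" "(\<lambda>C\<in>\<sigma>. y) B = undefined"
      using B unfolding bar_def by (meson PiE_arb)+
    with B X show False by simp
  qed
  from *[OF eq] *[OF eq[symmetric]] show ?thesis by blast
qed

lemma blocks_bar:
  assumes "\<exists>x\<in>X. \<exists>y\<in>X. x \<noteq> y" "partition_on X \<pi>"
  shows "blocks X (bar X \<pi>) = \<pi>"
proof -
  obtain x y where "x \<in> X" "y \<in> X" "x \<noteq> y" using assms(1) by blast
  then show ?thesis
    unfolding blocks_def using assms(2) by (intro the_equality) (auto dest: bar_inj)
qed

lemma star_inj:
  assumes X: "x \<in> X" "y \<in> X" "x \<noteq> y"
    and \<eta>: "\<eta> \<in> \<pi>\<^sub>2 \<rightarrow>\<^sub>E \<pi>\<^sub>1" and \<zeta>: "\<zeta> \<in> \<pi>\<^sub>2 \<rightarrow>\<^sub>E \<pi>\<^sub>1" and eq: "star X \<pi>\<^sub>1 \<pi>\<^sub>2 \<eta> = star X \<pi>\<^sub>1 \<pi>\<^sub>2 \<zeta>"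
  shows "\<eta> = \<zeta>"
proof (rule PiE_ext[OF \<eta> \<zeta>])
  fix B assume B: "B \<in> \<pi>\<^sub>2"
  let ?\<alpha> = "\<lambda>C\<in>\<pi>\<^sub>1. if C = \<eta> B then x else y"
  have "?\<alpha> \<in> bar X \<pi>\<^sub>1" using X by (auto simp: bar_def)
  then have "compose \<pi>\<^sub>2 ?\<alpha> \<eta> B = compose \<pi>\<^sub>2 ?\<alpha> \<zeta> B"
    using fun_cong[OF eq, of ?\<alpha>] by (simp add: star_def)
  then show "\<eta> B = \<zeta> B" using B \<eta> \<zeta> X by (auto simp: compose_def split: if_splits)
qed

lemma preimages_partition:
  assumes \<theta>: "bij_betw \<theta> X X" and \<pi>: "partition_on X \<pi>"
  shows "partition_on X (preimages X \<theta> \<pi>)"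
proof (rule partition_onI)
  show "\<Union>(preimages X \<theta> \<pi>) = X"
    using partition_onD1[OF \<pi>] bij_betwE[OF \<theta>] by (fastforce simp: preimages_def)
next
  fix p q assume pq: "p \<in> preimages X \<theta> \<pi>" "q \<in> preimages X \<theta> \<pi>" "p \<noteq> q"
  then obtain A B where AB: "A \<in> \<pi>" "B \<in> \<pi>" "p = \<theta> -` A \<inter> X" "q = \<theta> -` B \<inter> X"
    unfolding preimages_def by blast
  with pq have "A \<inter> B = {}"
    using disjointD[OF partition_onD2[OF \<pi>], of A B] by blast
  then show "disjnt p q" unfolding disjnt_def AB by blast
next
  have "\<theta> -` A \<inter> X \<noteq> {}" if "A \<in> \<pi>" for A
  proof -
    have "A \<noteq> {}" using that partition_onD3[OF \<pi>] by blast
    moreover have "A \<subseteq> \<theta> ` X"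
      using that partition_onD1[OF \<pi>] bij_betw_imp_surj_on[OF \<theta>] by blast
    ultimately show ?thesis by blast
  qed
  then show "{} \<notin> preimages X \<theta> \<pi>" by (auto simp: preimages_def)
qed

lemma cc_Gamma_obj:
  assumes "\<exists>x\<in>X. \<exists>y\<in>X. x \<noteq> y" "partition_on X \<pi>"
  shows "on_obj (cc_Gamma X \<theta>) (bar X \<pi>) = bar X (preimages X \<theta> \<pi>)"
  using blocks_bar[OF assms] by (simp add: cc_Gamma_def)

lemma cc_Gamma_mor:
  assumes X: "\<exists>x\<in>X. \<exists>y\<in>X. x \<noteq> y"
    and \<pi>: "partition_on X \<pi>\<^sub>1" "partition_on X \<pi>\<^sub>2" and \<eta>: "\<eta> \<in> \<pi>\<^sub>2 \<rightarrow>\<^sub>E \<pi>\<^sub>1"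
  shows "on_mor (cc_Gamma X \<theta>) (bar X \<pi>\<^sub>1) (bar X \<pi>\<^sub>2) (star X \<pi>\<^sub>1 \<pi>\<^sub>2 \<eta>) =
    star X (preimages X \<theta> \<pi>\<^sub>1) (preimages X \<theta> \<pi>\<^sub>2) (conj_blocks X \<theta> \<pi>\<^sub>2 \<eta>)"
proof -
  obtain x y where xy: "x \<in> X" "y \<in> X" "x \<noteq> y" using X by blast
  have "(THE \<zeta>. \<zeta> \<in> \<pi>\<^sub>2 \<rightarrow>\<^sub>E \<pi>\<^sub>1 \<and> star X \<pi>\<^sub>1 \<pi>\<^sub>2 \<eta> = star X \<pi>\<^sub>1 \<pi>\<^sub>2 \<zeta>) = \<eta>"
    using \<eta> by (intro the_equality) (auto dest: star_inj[OF xy])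
  then show ?thesis by (simp add: cc_Gamma_def blocks_bar[OF X] \<pi>)
qed

lemma cc_Gamma_in_objects:
  assumes X: "\<exists>x\<in>X. \<exists>y\<in>X. x \<noteq> y" and \<theta>: "bij_betw \<theta> X X" and P: "P \<in> partition_objects X"
  shows "on_obj (cc_Gamma X \<theta>) P \<in> partition_objects X"
proof -
  obtain \<pi> where \<pi>: "P = bar X \<pi>" "partition_on X \<pi>" "nonidentity \<pi>"
    using P by (auto simp: partition_objects_def)
  obtain B x y where B: "B \<in> \<pi>" "x \<in> B" "y \<in> B" "x \<noteq> y"
    using \<pi>(3) by (auto simp: nonidentity_def)
  have "x \<in> \<theta> ` X" "y \<in> \<theta> ` X"
    using B partition_onD1[OF \<pi>(2)] bij_betw_imp_surj_on[OF \<theta>] by blast+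
  then obtain u v where uv: "u \<in> X" "v \<in> X" "\<theta> u = x" "\<theta> v = y" by blast
  then have "u \<in> \<theta> -` B \<inter> X" "v \<in> \<theta> -` B \<inter> X" "u \<noteq> v" using B by auto
  moreover have "\<theta> -` B \<inter> X \<in> preimages X \<theta> \<pi>" using B(1) by (simp add: preimages_def)
  ultimately have "nonidentity (preimages X \<theta> \<pi>)" unfolding nonidentity_def by metis
  then show ?thesis
    using cc_Gamma_obj[OF X \<pi>(2)] preimages_partition[OF \<theta> \<pi>(2)] \<pi>(1)
    by (auto simp: partition_objects_def)
qed

lemma Units_full_transf: "Units (full_transf X) = {a \<in> X \<rightarrow>\<^sub>E X. bij_betw a X X}"
proof (intro equalityI subsetI)
  fix a assume "a \<in> Units (full_transf X)"
  then obtain c where a: "a \<in> X \<rightarrow>\<^sub>E X" and c: "c \<in> X \<rightarrow>\<^sub>E X"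
    and ca: "compose X a c = (\<lambda>x\<in>X. x)" and ac: "compose X c a = (\<lambda>x\<in>X. x)"
    by (auto simp: Units_def full_transf_def)
  have "bij_betw a X X"
  proof (rule bij_betwI[where g = c])
    show "a \<in> X \<rightarrow> X" "c \<in> X \<rightarrow> X" using a c by auto
    show "c (a x) = x" if "x \<in> X" for x using fun_cong[OF ac, of x] that by (simp add: compose_def)
    show "a (c x) = x" if "x \<in> X" for x using fun_cong[OF ca, of x] that by (simp add: compose_def)
  qed
  with a show "a \<in> {a \<in> X \<rightarrow>\<^sub>E X. bij_betw a X X}" by simp
next
  fix a assume "a \<in> {a \<in> X \<rightarrow>\<^sub>E X. bij_betw a X X}"
  then have a: "a \<in> X \<rightarrow>\<^sub>E X" "bij_betw a X X" by auto
  let ?c = "\<lambda>y\<in>X. inv_into X a y"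
  have "?c \<in> X \<rightarrow>\<^sub>E X" using bij_betwE[OF bij_betw_inv_into[OF a(2)]] by auto
  moreover have "compose X ?c a = (\<lambda>x\<in>X. x)" by (rule compose_inv_into_id[OF a(2)])
  moreover have "compose X a ?c = (\<lambda>x\<in>X. x)"
    using a(2) by (intro compose_id_inv_into) (simp add: bij_betw_def)
  ultimately have "\<exists>c\<in>X \<rightarrow>\<^sub>E X. compose X a c = (\<lambda>x\<in>X. x) \<and> compose X c a = (\<lambda>x\<in>X. x)"
    by blast
  with a(1) show "a \<in> Units (full_transf X)" by (simp add: Units_def full_transf_def)
qed

lemma Sing_set_alt: "Sing_set X = {a \<in> X \<rightarrow>\<^sub>E X. \<not> bij_betw a X X}"
  unfolding Sing_set_def Units_full_transf by (auto simp: full_transf_def)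

text \<open>The singular transformations are closed under composition precisely when \<open>X\<close> is finite:
  on an infinite set, an injective non-surjective transformation followed by a left inverse of it
  is the identity.\<close>

lemma subsemigroup_Sing_iff: "subsemigroup (Sing_set X) (full_transf X) \<longleftrightarrow> finite X"
proof
  assume fin: "finite X"
  have "compose X b a \<in> Sing_set X" if "a \<in> Sing_set X" "b \<in> Sing_set X" for a b
  proof -
    have a: "a \<in> X \<rightarrow>\<^sub>E X" "\<not> bij_betw a X X" and b: "b \<in> X \<rightarrow>\<^sub>E X"
      using that by (auto simp: Sing_set_alt)
    have "\<not> inj_on a X"
      using a endo_inj_surj[OF fin, of a] by (auto simp: bij_betw_def)
    then have "\<not> inj_on (compose X b a) X" by (force simp: inj_on_def compose_def)
    then show ?thesis using a b by (auto simp: Sing_set_alt bij_betw_def compose_def)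
  qed
  then show "subsemigroup (Sing_set X) (full_transf X)"
    by (auto simp: subsemigroup_def full_transf_def) (auto simp: Sing_set_alt)
next
  assume sub: "subsemigroup (Sing_set X) (full_transf X)"
  show "finite X"
  proof (rule ccontr)
    assume "infinite X"
    then obtain z where z: "z \<in> X" by fastforce
    obtain f where f: "bij_betw f X (X - {z})"
      using infinite_imp_bij_betw[OF \<open>infinite X\<close>] by blast
    let ?a = "restrict f X"
    let ?c = "\<lambda>y\<in>X. if y = z then z else inv_into X f y"
    have inv: "inv_into X f (f x) = x" if "x \<in> X" for x
      using f that by (simp add: bij_betw_def)
    have fX: "f x \<in> X" "f x \<noteq> z" if "x \<in> X" for x
      using bij_betwE[OF f] that by auto
    have "?a \<in> Sing_set X"
      using f z fX by (auto simp: Sing_set_alt bij_betw_def)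
    moreover have "?c \<in> Sing_set X"
    proof -
      have "?c \<in> X \<rightarrow>\<^sub>E X"
        using z bij_betwE[OF bij_betw_inv_into[OF f]] by auto
      moreover have "?c (f z) = ?c z" using z inv fX by simp
      ultimately show ?thesis
        using z fX[OF z] by (auto simp: Sing_set_alt bij_betw_def inj_on_def)
    qed
    ultimately have "compose X ?c ?a \<in> Sing_set X"
      using sub by (auto simp: subsemigroup_def full_transf_def)
    moreover have "compose X ?c ?a x = x" if "x \<in> X" for x
      using that inv fX by (simp add: compose_def)
    then have "bij_betw (compose X ?c ?a) X X"
      using bij_betw_cong[of X "compose X ?c ?a" id X] by simp
    ultimately show False by (simp add: Sing_set_alt)
  qed
qed

lemma blocks_kernel:
  assumes "\<exists>x\<in>X. \<exists>y\<in>X. x \<noteq> y"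
  shows "blocks X (bar X (kernel_partition X a)) = kernel_partition X a"
proof (rule blocks_bar[OF assms], rule partition_onI)
  show "\<Union>(kernel_partition X a) = X" by (auto simp: kernel_partition_def)
  show "{} \<notin> kernel_partition X a" by (auto simp: kernel_partition_def)
  show "disjnt p q"
    if "p \<in> kernel_partition X a" "q \<in> kernel_partition X a" "p \<noteq> q" for p q
    using that by (auto simp: kernel_partition_def disjnt_def)
qed

lemma partition_incl_kernel:
  assumes X: "\<exists>x\<in>X. \<exists>y\<in>X. x \<noteq> y" and \<pi>: "partition_on X \<pi>"
  shows "partition_incl X (bar X (kernel_partition X a)) (bar X \<pi>) \<longleftrightarrow>
    (\<forall>B\<in>\<pi>. \<forall>x\<in>B. \<forall>y\<in>B. a x = a y)" (is "?L \<longleftrightarrow> ?R")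
proof
  assume ?L
  show ?R
  proof (intro ballI)
    fix B x y assume B: "B \<in> \<pi>" "x \<in> B" "y \<in> B"
    obtain C where "C \<in> kernel_partition X a" "B \<subseteq> C"
      using \<open>?L\<close> B(1) by (auto simp: partition_incl_def blocks_kernel[OF X] blocks_bar[OF X \<pi>])
    then obtain z where "B \<subseteq> {y\<in>X. a y = z}" by (auto simp: kernel_partition_def)
    with B show "a x = a y" by (metis (mono_tags, lifting) mem_Collect_eq subsetD)
  qed
next
  assume R: ?R
  show ?L unfolding partition_incl_def blocks_kernel[OF X] blocks_bar[OF X \<pi>]
  proof
    fix B assume B: "B \<in> \<pi>"
    then have "B \<noteq> {}" using partition_onD3[OF \<pi>] by metis
    then obtain x where x: "x \<in> B" by blast
    have BX: "B \<subseteq> X" using B partition_onD1[OF \<pi>] by blast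
    then have "{y\<in>X. a y = a x} \<in> kernel_partition X a"
      using x by (auto simp: kernel_partition_def)
    moreover have "B \<subseteq> {y\<in>X. a y = a x}" using R B x BX by blast
    ultimately show "\<exists>C\<in>kernel_partition X a. B \<subseteq> C" by blast
  qed
qed

lemma Gamma_bi_iff:
  assumes X: "\<exists>x\<in>X. \<exists>y\<in>X. x \<noteq> y" and \<theta>: "bij_betw \<theta> X X" and \<pi>: "partition_on X \<pi>"
  shows "a \<in> Gamma_bi X \<theta> A (bar X \<pi>) \<longleftrightarrow> a \<in> Sing_set X \<and> a ` X \<subseteq> A \<and>
    (\<forall>B\<in>preimages X \<theta> \<pi>. \<forall>x\<in>B. \<forall>y\<in>B. a x = a y)"
  using partition_incl_kernel[OF X preimages_partition[OF \<theta> \<pi>]]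
  by (simp add: Gamma_bi_def cc_Gamma_obj[OF X \<pi>])

lemma Delta_bi_iff:
  assumes X: "\<exists>x\<in>X. \<exists>y\<in>X. x \<noteq> y" and \<pi>: "partition_on X \<pi>"
  shows "b \<in> Delta_bi X \<theta> A (bar X \<pi>) \<longleftrightarrow> b \<in> Sing_set X \<and> b ` X \<subseteq> \<theta> ` A \<and>
    (\<forall>B\<in>\<pi>. \<forall>x\<in>B. \<forall>y\<in>B. b x = b y)"
  using partition_incl_kernel[OF X \<pi>] by (simp add: Delta_bi_def cc_Delta_def)

lemma compose_in_Gamma_bi:
  assumes X: "\<exists>x\<in>X. \<exists>y\<in>X. x \<noteq> y" and \<theta>: "bij_betw \<theta> X X"
    and A: "A' \<in> powerset_objects X" and P: "P \<in> partition_objects X"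
    and a: "a \<in> Gamma_bi X \<theta> A P" and a': "a' \<in> Gamma_bi X \<theta> A' P'"
  shows "compose X a' a \<in> Gamma_bi X \<theta> A' P"
proof -
  obtain \<pi> where \<pi>: "P = bar X \<pi>" "partition_on X \<pi>"
    using P by (auto simp: partition_objects_def)
  have aX: "a \<in> X \<rightarrow>\<^sub>E X" and a'X: "a' \<in> X \<rightarrow>\<^sub>E X" "a' ` X \<subseteq> A'"
    using a a' by (auto simp: Gamma_bi_def Sing_set_alt)
  have im: "compose X a' a ` X \<subseteq> A'" using aX a'X(2) by (auto simp: compose_def)
  then have "compose X a' a ` X \<noteq> X" using A by (auto simp: powerset_objects_def)
  then have "compose X a' a \<in> Sing_set X"
    using aX a'X by (auto simp: Sing_set_alt bij_betw_def compose_def)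
  moreover have "\<forall>B\<in>preimages X \<theta> \<pi>. \<forall>x\<in>B. \<forall>y\<in>B. compose X a' a x = compose X a' a y"
  proof (intro ballI)
    fix B x y assume B: "B \<in> preimages X \<theta> \<pi>" "x \<in> B" "y \<in> B"
    then have "a x = a y" using a unfolding \<pi>(1) Gamma_bi_iff[OF X \<theta> \<pi>(2)] by blast
    moreover have "x \<in> X" "y \<in> X" using B by (auto simp: preimages_def)
    ultimately show "compose X a' a x = compose X a' a y" by (simp add: compose_def)
  qed
  ultimately show ?thesis unfolding \<pi>(1) Gamma_bi_iff[OF X \<theta> \<pi>(2)] using im by blast
qed

lemma duality_in_Delta_bi:
  assumes X: "\<exists>x\<in>X. \<exists>y\<in>X. x \<noteq> y" and \<theta>: "bij_betw \<theta> X X"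
    and A: "A \<in> powerset_objects X" and P: "P \<in> partition_objects X"
    and a: "a \<in> Gamma_bi X \<theta> A P"
  shows "duality X \<theta> A P a \<in> Delta_bi X \<theta> A P"
proof -
  obtain \<pi> where \<pi>: "P = bar X \<pi>" "partition_on X \<pi>"
    using P by (auto simp: partition_objects_def)
  have aX: "a \<in> X \<rightarrow>\<^sub>E X" and aA: "a ` X \<subseteq> A"
    using a by (auto simp: Gamma_bi_def Sing_set_alt)
  note inv = bij_betwE[OF bij_betw_inv_into[OF \<theta>]]
  define b where "b = duality X \<theta> A P a"
  have b: "b y = \<theta> (a (inv_into X \<theta> y))" if "y \<in> X" for y
    using that a by (simp add: b_def duality_def compose_def)
  have im: "b ` X \<subseteq> \<theta> ` A"
  proof
    fix z assume "z \<in> b ` X"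
    then obtain y where "y \<in> X" "z = \<theta> (a (inv_into X \<theta> y))" using b by blast
    then show "z \<in> \<theta> ` A" using inv aA by blast
  qed
  have "\<theta> ` A \<noteq> X"
    using A \<theta> inj_on_image_eq_iff[of \<theta> X A X] by (auto simp: powerset_objects_def bij_betw_def)
  moreover have "\<theta> ` A \<subseteq> X"
    using A bij_betwE[OF \<theta>] by (auto simp: powerset_objects_def)
  moreover have "b \<in> extensional X" using a by (simp add: b_def duality_def)
  moreover from calculation have "b \<in> X \<rightarrow>\<^sub>E X" using im by (simp add: PiE_def) blast
  ultimately have "b \<in> Sing_set X"
    using im by (auto simp: Sing_set_alt bij_betw_def)
  moreover have "\<forall>B\<in>\<pi>. \<forall>x\<in>B. \<forall>y\<in>B. b x = b y"
  proof (intro ballI)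
    fix B x y assume B: "B \<in> \<pi>" "x \<in> B" "y \<in> B"
    then have xy: "x \<in> X" "y \<in> X" using partition_onD1[OF \<pi>(2)] by auto
    then have "inv_into X \<theta> x \<in> \<theta> -` B \<inter> X" "inv_into X \<theta> y \<in> \<theta> -` B \<inter> X"
      using B inv bij_betw_inv_into_right[OF \<theta>] by auto
    moreover have "\<theta> -` B \<inter> X \<in> preimages X \<theta> \<pi>" using B(1) by (simp add: preimages_def)
    moreover have "\<forall>B\<in>preimages X \<theta> \<pi>. \<forall>x\<in>B. \<forall>y\<in>B. a x = a y"
      using Gamma_bi_iff[OF X \<theta> \<pi>(2), THEN iffD1, OF a[unfolded \<pi>(1)]] by blast
    ultimately have "a (inv_into X \<theta> x) = a (inv_into X \<theta> y)" by metis
    then show "b x = b y" using b xy by simp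
  qed
  ultimately have "b \<in> Delta_bi X \<theta> A (bar X \<pi>)"
    unfolding Delta_bi_iff[OF X \<pi>(2)] using im by blast
  then show ?thesis unfolding b_def \<pi>(1) .
qed

text \<open>The operation of \<open>cc_semigroup\<close> is well defined.\<close>

lemma cc_semigroup_closed:
  assumes X: "\<exists>x\<in>X. \<exists>y\<in>X. x \<noteq> y" and \<theta>: "bij_betw \<theta> X X"
    and s: "s \<in> carrier (cc_semigroup X \<theta>)" and t: "t \<in> carrier (cc_semigroup X \<theta>)"
  shows "s \<otimes>\<^bsub>cc_semigroup X \<theta>\<^esub> t \<in> carrier (cc_semigroup X \<theta>)"
proof -
  obtain a b A P where s': "s = (a, b)" "A \<in> powerset_objects X" "P \<in> partition_objects X"
    "a \<in> Gamma_bi X \<theta> A P" "b = duality X \<theta> A P a"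
    using s by (auto simp: cc_semigroup_def linked_def)
  obtain a' b' A' P' where t': "t = (a', b')" "A' \<in> powerset_objects X" "P' \<in> partition_objects X"
    "a' \<in> Gamma_bi X \<theta> A' P'" "b' = duality X \<theta> A' P' a'"
    using t by (auto simp: cc_semigroup_def linked_def)
  have aa': "compose X a' a \<in> Gamma_bi X \<theta> A' P"
    by (rule compose_in_Gamma_bi[OF X \<theta> t'(2) s'(3,4) t'(4)])
  have aX: "a \<in> X \<rightarrow>\<^sub>E X" using s'(4) by (auto simp: Gamma_bi_def Sing_set_alt)
  note inv = bij_betwE[OF bij_betw_inv_into[OF \<theta>]]
  have "compose X b' b = duality X \<theta> A' P (compose X a' a)"
  proof (rule extensionalityI)
    show "compose X b' b \<in> extensional X" by simp
    show "duality X \<theta> A' P (compose X a' a) \<in> extensional X" using aa' by (simp add: duality_def)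
    fix x assume x: "x \<in> X"
    have "inv_into X \<theta> x \<in> X" using inv x by blast
    moreover from this have "a (inv_into X \<theta> x) \<in> X" using aX by blast
    moreover from this have "\<theta> (a (inv_into X \<theta> x)) \<in> X" using bij_betwE[OF \<theta>] by blast
    ultimately show "compose X b' b x = duality X \<theta> A' P (compose X a' a) x"
      using x aa' s'(4,5) t'(4,5) bij_betw_inv_into_left[OF \<theta>]
      by (simp add: duality_def compose_def)
  qed
  then have "linked X \<theta> (compose X a' a) (compose X b' b)"
    using aa' t'(2) s'(3) unfolding linked_def by blast
  moreover have "compose X b' b \<in> Delta_bi X \<theta> A' P"
    unfolding \<open>compose X b' b = _\<close> by (rule duality_in_Delta_bi[OF X \<theta> t'(2) s'(3) aa'])
  ultimately show ?thesis
    using aa' t'(2) s'(3) unfolding s'(1) t'(1)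
    by (auto simp: cc_semigroup_def U_Gamma_def U_Delta_def full_transf_def)
qed

end

(* The isomorphism is the first projection: b is the conjugate of a by theta, independently of
   the pair (A, P) witnessing the link, so the projection is injective. It is surjective because
   the semigroup assumption forces X to be finite, so that a singular a is neither surjective
   (its image is an object of the powerset category) nor injective (its kernel, transported by
   theta, is an object of the category of partitions). *)

theory Submission
  imports Defs
begin

lemma partition_on_kernel: "partition_on X (kernel_partition X a)"
  by (rule partition_onI) (auto simp: kernel_partition_def disjnt_def)

text \<open>By counting, injectivity and surjectivity of a self-map of a finite set each force
  bijectivity.\<close>

lemma Sing_set_finite:
  assumes "finite X" "a \<in> Sing_set X"
  shows "\<not> inj_on a X" "a ` X \<noteq> X"
proof -
  have a: "a ` X \<subseteq> X" "\<not> bij_betw a X X"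
    using assms(2) by (auto simp: Sing_set_alt)
  show "\<not> inj_on a X" using a endo_inj_surj[OF assms(1)] by (auto simp: bij_betw_def)
  show "a ` X \<noteq> X" using a eq_card_imp_inj_on[OF assms(1), of a] by (auto simp: bij_betw_def)
qed

lemma Sing_set_in_Gamma_bi:
  assumes X: "\<exists>x\<in>X. \<exists>y\<in>X. x \<noteq> y" and \<theta>: "bij_betw \<theta> X X"
    and fin: "finite X" and a: "a \<in> Sing_set X"
  obtains A P where "A \<in> powerset_objects X" "P \<in> partition_objects X" "a \<in> Gamma_bi X \<theta> A P"
proof
  \<comment> \<open>\<open>cc_Gamma\<close> pulls blocks back along \<open>\<theta>\<close>, so
    \<open>a\<close> is precomposed with the inverse of \<open>\<theta>\<close>:
    \<open>preimages X \<theta> ?\<pi>\<close> is then the kernel partition of \<open>a\<close>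
    itself.\<close>
  let ?\<pi> = "kernel_partition X (\<lambda>x. a (inv_into X \<theta> x))"
  note left = bij_betw_inv_into_left[OF \<theta>]
  have "a ` X \<subseteq> X" using a by (auto simp: Sing_set_alt)
  with X Sing_set_finite(2)[OF fin a] show "a ` X \<in> powerset_objects X"
    by (auto simp: powerset_objects_def)
  obtain x y where xy: "x \<in> X" "y \<in> X" "x \<noteq> y" "a x = a y"
    using Sing_set_finite(1)[OF fin a] by (auto simp: inj_on_def)
  \<comment> \<open>The block of \<open>?\<pi>\<close> holding the \<open>\<theta>\<close>-images of
    two points that \<open>a\<close> identifies.\<close>
  let ?B = "{z \<in> X. a (inv_into X \<theta> z) = a x}"
  have B: "\<theta> x \<in> ?B" "\<theta> y \<in> ?B" using xy left bij_betwE[OF \<theta>] by simp_all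
  then have "a x \<in> (\<lambda>z. a (inv_into X \<theta> z)) ` X" by force
  then have mem: "?B \<in> ?\<pi>" unfolding kernel_partition_def by (rule imageI)
  have neq: "\<theta> x \<noteq> \<theta> y" using xy \<theta> by (auto simp: bij_betw_def inj_on_def)
  have "nonidentity ?\<pi>" unfolding nonidentity_def
    by (rule bexI[OF _ mem], rule bexI[OF _ B(1)], rule bexI[OF _ B(2)], rule neq)
  then show "bar X ?\<pi> \<in> partition_objects X"
    using partition_on_kernel by (auto simp: partition_objects_def)
  have "\<forall>B\<in>preimages X \<theta> ?\<pi>. \<forall>x\<in>B. \<forall>y\<in>B. a x = a y"
    using left by (auto simp: preimages_def kernel_partition_def)
  then show "a \<in> Gamma_bi X \<theta> (a ` X) (bar X ?\<pi>)"
    unfolding Gamma_bi_iff[OF X \<theta> partition_on_kernel] using a by blast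
qed

text \<open>Every \<open>duality X \<theta> A P\<close> restricts one and the same conjugation by
  \<open>\<theta>\<close>, so the linked pairs form its graph.\<close>

lemma cc_semigroup_carrier:
  assumes X: "\<exists>x\<in>X. \<exists>y\<in>X. x \<noteq> y" and \<theta>: "bij_betw \<theta> X X" and fin: "finite X"
  shows "carrier (cc_semigroup X \<theta>) =
    (\<lambda>a. (a, compose X \<theta> (compose X a (inv_into X \<theta>)))) ` Sing_set X" (is "_ = ?f ` _")
proof (intro equalityI subsetI)
  fix s assume "s \<in> carrier (cc_semigroup X \<theta>)"
  then show "s \<in> ?f ` Sing_set X"
    by (auto simp: cc_semigroup_def linked_def duality_def Gamma_bi_def)
next
  fix s assume "s \<in> ?f ` Sing_set X"
  then obtain a where a: "a \<in> Sing_set X" "s = ?f a" by blast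
  obtain A P where AP: "A \<in> powerset_objects X" "P \<in> partition_objects X" "a \<in> Gamma_bi X \<theta> A P"
    using Sing_set_in_Gamma_bi[OF X \<theta> fin a(1)] .
  then have s: "s = (a, duality X \<theta> A P a)" by (simp add: a(2) duality_def)
  then show "s \<in> carrier (cc_semigroup X \<theta>)"
    using AP duality_in_Delta_bi[OF X \<theta> AP]
    by (auto simp: cc_semigroup_def U_Gamma_def U_Delta_def linked_def)
qed

theorem theorem4p13:
  fixes X :: "'a set" and \<theta> :: "'a \<Rightarrow> 'a"
  assumes "\<exists>x\<in>X. \<exists>y\<in>X. x \<noteq> y"
    and "bij_betw \<theta> X X"
    and "subsemigroup (Sing_set X) (full_transf X)"
  shows "cc_semigroup X \<theta> \<cong> Sing X"
proof -
  have fin: "finite X" using assms(3) by (simp add: subsemigroup_Sing_iff)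
  note carrier = cc_semigroup_carrier[OF assms(1,2) fin]
  have "fst \<in> hom (cc_semigroup X \<theta>) (Sing X)"
  proof (rule homI)
    show "fst s \<in> carrier (Sing X)" if "s \<in> carrier (cc_semigroup X \<theta>)" for s
      using that by (auto simp: carrier Sing_def)
    \<comment> \<open>Both sides use the product of \<open>full_transf X\<close>.\<close>
    show "fst (s \<otimes>\<^bsub>cc_semigroup X \<theta>\<^esub> t) = fst s \<otimes>\<^bsub>Sing X\<^esub> fst t" for s t
      by (simp add: cc_semigroup_def U_Gamma_def Sing_def split_beta)
  qed
  moreover have "bij_betw fst (carrier (cc_semigroup X \<theta>)) (carrier (Sing X))"
    \<comment> \<open>A graph projects bijectively onto its domain.\<close>
    by (auto simp: carrier Sing_def bij_betw_def inj_on_def image_image)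
  ultimately show ?thesis unfolding is_iso_def iso_def by blast
qed

end
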